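(* If $f\in L^1(\mathbb{R}^n)\cap L^\infty(\mathbb{R}^n)$ has compact support, then $$\lim_{p\to1^+}(p-1)\|Mf\|_{L^p(\mathbb{R}^n)}^p=\|f\|_{L^1(\mathbb{R}^n)}.$$
   Context: $Mf(x)=\sup_{r>0}\frac1{|B(x,r)|}\int_{B(x,r)}|f(y)|\,dy$ is the centered Hardy–Littlewood maximal function. *)

theory Defs
  imports "HOL-Analysis.Analysis" "HOL-Probability.Essential_Supremum"
begin

text \<open>
  Maximal functions and norms take values in \<^typ>\<open>ennreal\<close>, so that neither the supremum
  nor the integrals can be silently replaced by a default real value.
\<close>

text \<open>Powers on \<open>[0, \<infinity>]\<close>, only meaningful for exponents \<open>p > 0\<close>.\<close>

definition ennreal_powr :: "ennreal \<Rightarrow> real \<Rightarrow> ennreal" where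
  "ennreal_powr x p = (if x = \<infinity> then \<infinity> else ennreal (enn2real x powr p))"

definition Lp_norm :: "real \<Rightarrow> (real^'n \<Rightarrow> ennreal) \<Rightarrow> ennreal" where
  "Lp_norm p g = ennreal_powr (\<integral>\<^sup>+ x. ennreal_powr (g x) p \<partial>lebesgue) (1 / p)"

definition pointwise_abs :: "(real^'n \<Rightarrow> complex) \<Rightarrow> real^'n \<Rightarrow> ennreal" where
  "pointwise_abs f x = ennreal (norm (f x))"

definition in_Linf :: "(real^'n \<Rightarrow> complex) \<Rightarrow> bool" where
  "in_Linf f \<longleftrightarrow> f \<in> borel_measurable lebesgue \<and> esssup lebesgue (pointwise_abs f) < \<infinity>"

text \<open>
  The support of an element of a Lebesgue space, which is only determined up to null sets: the
  complement of the largest open set on which \<open>f\<close> vanishes almost everywhere. For continuous \<open>f\<close>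
  it is the closure of \<open>{x. f x \<noteq> 0}\<close>; in general it is contained in that closure.
\<close>

definition ess_support :: "(real^'n \<Rightarrow> complex) \<Rightarrow> (real^'n) set" where
  "ess_support f = - \<Union>{U. open U \<and> (AE x in lebesgue. x \<in> U \<longrightarrow> f x = 0)}"

definition maximal_function :: "(real^'n \<Rightarrow> complex) \<Rightarrow> real^'n \<Rightarrow> ennreal" where
  "maximal_function f x =
     (SUP r\<in>{0<..}. (\<integral>\<^sup>+ y\<in>ball x r. ennreal (norm (f y)) \<partial>lebesgue) / emeasure lebesgue (ball x r))"

end

theory Submission
  imports Defs "HOL-Real_Asymp.Real_Asymp"
begin

text \<open>
  Since \<open>f\<close> vanishes almost everywhere outside some ball of radius \<open>R\<close> around the origin, \<open>Mf(x)\<close> lies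
  between \<open>\<parallel>f\<parallel>\<^sub>1 / |B(0, |x| + R)|\<close> and \<open>\<parallel>f\<parallel>\<^sub>1 / |B(0, |x| - R)|\<close> for \<open>|x| > R\<close>. So, for every \<open>c > 1\<close>,
  \<open>Mf(x)\<close> agrees up to a factor \<open>c\<close> with \<open>\<parallel>f\<parallel>\<^sub>1 / u(x)\<close> for large \<open>x\<close>, where \<open>u(x) = |B(0, |x|)|\<close>. As \<open>u\<close> pushes
  Lebesgue measure forward to Lebesgue measure on \<open>[0, \<infinity>)\<close>, the integral of \<open>(D / u)\<^sup>p\<close> over
  \<open>{u \<ge> s\<^sub>0}\<close> is \<open>D\<^sup>p s\<^sub>0\<^bsup>1 - p\<^esup> / (p - 1)\<close>, and multiplied by \<open>p - 1\<close> this tends to \<open>D\<close>. The part over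
  \<open>{u < s\<^sub>0}\<close> stays bounded because \<open>Mf\<close> is bounded, and disappears in the limit.
\<close>

section \<open>Ball volumes as a radial variable\<close>

text \<open>The dimension enters only through the type, hence the \<open>itself\<close>
  argument.\<close>

definition ball_vol :: "real \<Rightarrow> 'a::euclidean_space itself \<Rightarrow> real" where
  "ball_vol r _ = unit_ball_vol (DIM('a)) * r ^ DIM('a)"

lemma emeasure_lborel_ball:
  fixes x :: "'a::euclidean_space"
  assumes "r \<ge> 0"
  shows "emeasure lborel (ball x r) = ennreal (ball_vol r TYPE('a))"
  using emeasure_ball[OF assms, of x] by (simp add: ball_vol_def)

lemma ball_vol_pos: "r > 0 \<Longrightarrow> ball_vol r TYPE('a::euclidean_space) > 0"
  by (simp add: ball_vol_def)

lemma ball_vol_nonneg: "r \<ge> 0 \<Longrightarrow> ball_vol r TYPE('a::euclidean_space) \<ge> 0"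
  by (simp add: ball_vol_def)

lemma ball_vol_mono:
  "0 \<le> r \<Longrightarrow> r \<le> s \<Longrightarrow> ball_vol r TYPE('a::euclidean_space) \<le> ball_vol s TYPE('a)"
  by (simp add: ball_vol_def power_mono mult_left_mono)

lemma ball_vol_less_iff:
  "0 \<le> r \<Longrightarrow> 0 \<le> s \<Longrightarrow>
    ball_vol r TYPE('a::euclidean_space) < ball_vol s TYPE('a) \<longleftrightarrow> r < s"
  by (auto simp: ball_vol_def intro: power_strict_mono power_less_imp_less_base)

lemma ball_vol_surj:
  assumes "s > 0"
  obtains r where "r > 0" "ball_vol r TYPE('a::euclidean_space) = s"
proof
  let ?V = "unit_ball_vol (DIM('a))"
  show "root DIM('a) (s / ?V) > 0"
    using assms by simp
  show "ball_vol (root DIM('a) (s / ?V)) TYPE('a) = s"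
    using assms less_imp_neq[OF unit_ball_vol_pos[of "real DIM('a)"]] by (simp add: ball_vol_def)
qed

lemma borel_measurable_ball_vol_norm [measurable]:
  "(\<lambda>x::'a::euclidean_space. ball_vol (norm x) TYPE('a)) \<in> borel_measurable borel"
  by (simp add: ball_vol_def)

text \<open>The sign is flipped so that the rays \<open>{y<..}\<close> have finite measure.\<close>

lemma distr_neg_ball_vol_norm:
  "distr lborel borel (\<lambda>x::'a::euclidean_space. - ball_vol (norm x) TYPE('a))
     = density lborel (indicator {..0::real})" (is "?M = ?N")
proof (rule measure_eqI_lessThan)
  \<comment> \<open>The ray pulls back to a ball of volume \<open>- y\<close> if
    \<open>y < 0\<close> and to the empty set otherwise; \<open>ennreal\<close> truncates negative
    reals to 0, so one formula covers both cases.\<close>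
  have M: "emeasure ?M {y<..} = ennreal (- y)" for y
  proof -
    have "emeasure ?M {y<..} = emeasure lborel {x::'a. ball_vol (norm x) TYPE('a) < - y}"
      by (subst emeasure_distr) (auto intro!: arg_cong2[where f = emeasure])
    also have "\<dots> = ennreal (- y)"
    proof (cases "y < 0")
      case True
      then obtain r where r: "r > 0" "ball_vol r TYPE('a) = - y"
        using ball_vol_surj[of "- y"] by auto
      have "{x::'a. ball_vol (norm x) TYPE('a) < - y} = ball 0 r"
        using r by (auto simp flip: r(2) simp: ball_vol_less_iff)
      then show ?thesis
        using r emeasure_ball[of r "0::'a"] by (simp add: ball_vol_def)
    next
      case False
      then have "{x::'a. ball_vol (norm x) TYPE('a) < - y} = {}"
        by (auto simp: not_less intro!: order_trans[of "- y" 0 "ball_vol _ _"] ball_vol_nonneg)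
      then show ?thesis
        using False by (simp add: ennreal_neg)
    qed
    finally show ?thesis .
  qed
  show "emeasure ?M {y<..} < \<infinity>" for y
    by (simp add: M)
  show "emeasure ?M {y<..} = emeasure ?N {y<..}" for y
  proof -
    have "emeasure ?N {y<..} = (\<integral>\<^sup>+x. indicator {y<..0} x \<partial>lborel)"
      by (subst emeasure_density, simp, simp, intro nn_integral_cong) (auto split: split_indicator)
    also have "\<dots> = ennreal (- y)"
      by (cases "y \<le> 0") (auto simp: ennreal_neg)
    finally show ?thesis
      using M by simp
  qed
qed simp_all

text \<open>A substitute for polar coordinates: with volume in place of radius as the variable, the
  Jacobian is 1 in every dimension.\<close>

lemma nn_integral_ball_vol_norm:
  fixes g :: "real \<Rightarrow> ennreal"
  assumes [measurable]: "g \<in> borel_measurable borel"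
  shows "(\<integral>\<^sup>+x. g (ball_vol (norm x) TYPE('a)) \<partial>(lebesgue :: 'a::euclidean_space measure))
    = (\<integral>\<^sup>+s. g s * indicator {0..} s \<partial>lborel)"
proof -
  have "(\<integral>\<^sup>+x. g (ball_vol (norm x) TYPE('a)) \<partial>(lebesgue :: 'a measure))
      = (\<integral>\<^sup>+s. g (- s) \<partial>distr lborel borel (\<lambda>x::'a. - ball_vol (norm x) TYPE('a)))"
    by (subst nn_integral_distr) (auto simp: nn_integral_completion)
  also have "\<dots> = (\<integral>\<^sup>+s. indicator {..0} s * g (- s) \<partial>lborel)"
    by (simp add: distr_neg_ball_vol_norm nn_integral_density)
  also have "\<dots> = (\<integral>\<^sup>+s. indicator {..0} (- s) * g s \<partial>lborel)"
    by (subst nn_integral_real_affine[where c = "-1" and t = 0]) auto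
  also have "\<dots> = (\<integral>\<^sup>+s. g s * indicator {0..} s \<partial>lborel)"
    by (auto intro!: nn_integral_cong split: split_indicator)
  finally show ?thesis .
qed

section \<open>Radial integrals over the far and the near region\<close>

text \<open>Since \<open>p > 1\<close>, the antiderivative of the integrand vanishes at infinity.
  The resulting denominator \<open>p - 1\<close> is what the factor in the theorem cancels.\<close>

lemma nn_integral_powr_tail:
  fixes D p s\<^sub>0 :: real
  assumes "D \<ge> 0" "p > 1" "s\<^sub>0 > 0"
  shows "(\<integral>\<^sup>+s. ennreal ((D / s) powr p) * indicator {s\<^sub>0..} s \<partial>lborel)
    = ennreal (D powr p * s\<^sub>0 powr (1 - p) / (p - 1))"
proof -
  let ?F = "\<lambda>s. D powr p * s powr (1 - p) / (1 - p)"
  have "(\<integral>\<^sup>+s. ennreal ((D / s) powr p) * indicator {s\<^sub>0..} s \<partial>lborel) = ennreal (0 - ?F s\<^sub>0)"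
  proof (rule nn_integral_FTC_atLeast)
    show "DERIV ?F s :> (D / s) powr p" if "s\<^sub>0 \<le> s" for s
    proof -
      have s: "s > 0"
        using that assms by simp
      have "DERIV ?F s :> D powr p * ((1 - p) * s powr (1 - p - 1)) / (1 - p)"
        using s by (auto intro!: derivative_eq_intros)
      also have "D powr p * ((1 - p) * s powr (1 - p - 1)) / (1 - p) = D powr p * s powr (- p)"
        using assms by simp
      also have "\<dots> = (D / s) powr p"
        using s assms by (simp add: powr_divide powr_minus_divide)
      finally show ?thesis .
    qed
    have "((\<lambda>s. s powr (1 - p)) \<longlongrightarrow> 0) at_top"
      using assms by (intro tendsto_neg_powr filterlim_ident) auto
    then show "(?F \<longlongrightarrow> 0) at_top"
      using assms by (intro tendsto_divide_zero tendsto_mult_right_zero)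
  qed auto
  also have "0 - ?F s\<^sub>0 = D powr p * s\<^sub>0 powr (1 - p) / (p - 1)"
    using minus_divide_right[of "D powr p * s\<^sub>0 powr (1 - p)" "1 - p"] by simp
  finally show ?thesis .
qed

lemma nn_integral_ball_vol_norm_powr_tail:
  fixes D p s\<^sub>0 :: real
  assumes "D \<ge> 0" "p > 1" "s\<^sub>0 > 0"
  shows "(\<integral>\<^sup>+x. ennreal ((D / ball_vol (norm x) TYPE('a)) powr p)
        * indicator {s\<^sub>0..} (ball_vol (norm x) TYPE('a)) \<partial>(lebesgue :: 'a::euclidean_space measure))
    = ennreal (D powr p * s\<^sub>0 powr (1 - p) / (p - 1))"
proof -
  have "(\<integral>\<^sup>+x. ennreal ((D / ball_vol (norm x) TYPE('a)) powr p)
        * indicator {s\<^sub>0..} (ball_vol (norm x) TYPE('a)) \<partial>(lebesgue :: 'a measure))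
    = (\<integral>\<^sup>+s. ennreal ((D / s) powr p) * indicator {s\<^sub>0..} s * indicator {0..} s \<partial>lborel)"
    by (rule nn_integral_ball_vol_norm) measurable
  also have "\<dots> = (\<integral>\<^sup>+s. ennreal ((D / s) powr p) * indicator {s\<^sub>0..} s \<partial>lborel)"
    using assms by (intro nn_integral_cong) (auto split: split_indicator)
  finally show ?thesis
    using nn_integral_powr_tail[OF assms] by simp
qed

lemma nn_integral_ball_vol_norm_below:
  assumes "s\<^sub>0 \<ge> 0"
  shows "(\<integral>\<^sup>+x. indicator {..<s\<^sub>0} (ball_vol (norm x) TYPE('a)) \<partial>(lebesgue :: 'a::euclidean_space measure))
    = ennreal s\<^sub>0"
proof -
  have "(\<integral>\<^sup>+x. indicator {..<s\<^sub>0} (ball_vol (norm x) TYPE('a)) \<partial>(lebesgue :: 'a measure))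
    = (\<integral>\<^sup>+s. indicator {..<s\<^sub>0} s * indicator {0..} s \<partial>lborel)"
    by (rule nn_integral_ball_vol_norm) measurable
  also have "\<dots> = (\<integral>\<^sup>+s. indicator {0..<s\<^sub>0} s \<partial>lborel)"
    by (intro nn_integral_cong) (auto split: split_indicator)
  finally show ?thesis
    using assms by simp
qed

section \<open>Volume comparison at large radii\<close>

text \<open>Quotients of volumes are powers of quotients of radii, and shifting a radius by a fixed
  \<open>R\<close> changes it by a factor tending to 1.\<close>

lemma eventually_ball_vol_shift:
  fixes R c :: real
  assumes "c > 1"
  shows "\<forall>\<^sub>F t in at_top. R < t \<and> ball_vol (t + R) TYPE('a::euclidean_space) \<le> c * ball_vol t TYPE('a)
    \<and> ball_vol t TYPE('a) \<le> c * ball_vol (t - R) TYPE('a)"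
proof -
  have "((\<lambda>t. (t + R) / t) \<longlongrightarrow> 1) at_top" "((\<lambda>t. t / (t - R)) \<longlongrightarrow> 1) at_top"
    by real_asymp+
  then have "((\<lambda>t. ((t + R) / t) ^ DIM('a)) \<longlongrightarrow> 1 ^ DIM('a)) at_top"
    "((\<lambda>t. (t / (t - R)) ^ DIM('a)) \<longlongrightarrow> 1 ^ DIM('a)) at_top"
    by (auto intro: tendsto_power simp del: power_one)
  then have "\<forall>\<^sub>F t in at_top. ((t + R) / t) ^ DIM('a) < c" "\<forall>\<^sub>F t in at_top. (t / (t - R)) ^ DIM('a) < c"
    using assms by (auto dest: order_tendstoD(2))
  \<comment> \<open>This makes \<open>t\<close> and \<open>t - R\<close> positive, so that the
    denominators can be cleared.\<close>
  moreover have "\<forall>\<^sub>F t in at_top. max 0 R < t"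
    by (rule eventually_gt_at_top)
  ultimately show ?thesis
  proof eventually_elim
    case (elim t)
    then have "(t + R) ^ DIM('a) \<le> c * t ^ DIM('a)" "t ^ DIM('a) \<le> c * (t - R) ^ DIM('a)"
      by (auto simp: power_divide divide_simps)
    then have "unit_ball_vol DIM('a) * (t + R) ^ DIM('a) \<le> unit_ball_vol DIM('a) * (c * t ^ DIM('a))"
      "unit_ball_vol DIM('a) * t ^ DIM('a) \<le> unit_ball_vol DIM('a) * (c * (t - R) ^ DIM('a))"
      by (auto intro!: mult_left_mono)
    with elim show ?case
      by (auto simp: ball_vol_def mult_ac)
  qed
qed

section \<open>Powers of extended reals and the essential support\<close>

lemma ennreal_powr_ennreal: "x \<ge> 0 \<Longrightarrow> ennreal_powr (ennreal x) p = ennreal (x powr p)"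
  by (simp add: ennreal_powr_def)

text \<open>Turns the p-th power of an L^p norm back into the plain integral, also when that
  integral is infinite.\<close>

lemma ennreal_powr_inverse:
  assumes "p > 0"
  shows "ennreal_powr (ennreal_powr x (1 / p)) p = x"
  using assms by (cases x) (auto simp: ennreal_powr_def powr_powr)

lemma ennreal_powr_mono:
  assumes "x \<le> y" "p > 0"
  shows "ennreal_powr x p \<le> ennreal_powr y p"
  using assms by (cases x; cases y) (auto simp: ennreal_powr_def powr_mono2 top_unique)

text \<open>The complement of the support may be a union of uncountably many open sets, each with
  its own null set. By Lindelof, countably many of them have the same union, and countably many null
  sets can be discarded at once.\<close>

lemma AE_eq_0_outside_ess_support:
  "AE x in lebesgue. x \<notin> ess_support f \<longrightarrow> f x = 0"
proof -
  obtain \<U> where \<U>: "\<U> \<subseteq> {U. open U \<and> (AE x in lebesgue. x \<in> U \<longrightarrow> f x = 0)}" "countable \<U>"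
    "\<Union>\<U> = \<Union>{U. open U \<and> (AE x in lebesgue. x \<in> U \<longrightarrow> f x = 0)}"
    by (rule Lindelof[of "{U. open U \<and> (AE x in lebesgue. x \<in> U \<longrightarrow> f x = 0)}"]) auto
  have "AE x in lebesgue. \<forall>U\<in>\<U>. x \<in> U \<longrightarrow> f x = 0"
    using \<U> by (subst AE_ball_countable) auto
  then show ?thesis
    by eventually_elim (auto simp: ess_support_def simp flip: \<U>(3))
qed

section \<open>Pointwise bounds for the maximal function\<close>

lemma maximal_function_le_bound:
  fixes f :: "real^'n \<Rightarrow> complex"
  assumes "AE y in lebesgue. ennreal (norm (f y)) \<le> K"
  shows "maximal_function f x \<le> K"
  unfolding maximal_function_def
proof (rule SUP_least)
  fix r :: real assume "r \<in> {0<..}"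
  have "(\<integral>\<^sup>+y\<in>ball x r. ennreal (norm (f y)) \<partial>lebesgue) \<le> (\<integral>\<^sup>+y. K * indicator (ball x r) y \<partial>lebesgue)"
    using assms by (intro nn_integral_mono_AE) (auto split: split_indicator elim!: eventually_mono)
  also have "\<dots> = K * emeasure lebesgue (ball x r)"
    by (subst nn_integral_cmult_indicator) auto
  finally show "(\<integral>\<^sup>+y\<in>ball x r. ennreal (norm (f y)) \<partial>lebesgue) / emeasure lebesgue (ball x r) \<le> K"
    using \<open>r \<in> {0<..}\<close>
    by (intro divide_le_posI_ennreal)
       (auto simp: mult.commute emeasure_lborel_ball ball_vol_pos)
qed

text \<open>A ball around \<open>x\<close> of radius at most \<open>norm x - R\<close> misses the
  region where \<open>f\<close> lives, so its average is 0. A larger ball catches at most the whole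
  mass \<open>F\<close> and has at least the stated volume.\<close>

lemma maximal_function_le_far:
  fixes f :: "real^'n \<Rightarrow> complex"
  assumes supp: "AE y in lebesgue. norm y \<ge> R \<longrightarrow> f y = 0"
    and F: "(\<integral>\<^sup>+y. ennreal (norm (f y)) \<partial>lebesgue) = ennreal F" "F \<ge> 0"
    and x: "norm x > R"
  shows "maximal_function f x \<le> ennreal (F / ball_vol (norm x - R) TYPE(real^'n))"
  unfolding maximal_function_def
proof (rule SUP_least)
  fix r :: real assume "r \<in> {0<..}"
  then have r: "r > 0" by simp
  let ?I = "\<integral>\<^sup>+y\<in>ball x r. ennreal (norm (f y)) \<partial>lebesgue"
  show "?I / emeasure lebesgue (ball x r) \<le> ennreal (F / ball_vol (norm x - R) TYPE(real^'n))"
  proof (cases "r \<le> norm x - R")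
    case True
    have "norm y \<ge> R" if "y \<in> ball x r" for y
      using that True norm_triangle_ineq2[of x y] by (auto simp: dist_norm)
    then have "AE y in lebesgue. ennreal (norm (f y)) * indicator (ball x r) y = 0"
      using supp by (auto split: split_indicator elim!: eventually_mono)
    then have "?I = (\<integral>\<^sup>+y. 0 \<partial>(lebesgue :: (real^'n) measure))"
      by (rule nn_integral_cong_AE)
    then show ?thesis
      by simp
  next
    case False
    have "?I \<le> ennreal F"
      unfolding F(1)[symmetric] by (intro nn_integral_mono) (auto split: split_indicator)
    then have "?I / emeasure lebesgue (ball x r) \<le> ennreal F / emeasure lebesgue (ball x r)"
      by (rule divide_right_mono_ennreal)
    also have "\<dots> = ennreal (F / ball_vol r TYPE(real^'n))"
      using r F by (simp add: emeasure_lborel_ball divide_ennreal ball_vol_pos)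
    also have "\<dots> \<le> ennreal (F / ball_vol (norm x - R) TYPE(real^'n))"
      using r F x False
      by (intro ennreal_leI divide_left_mono ball_vol_mono mult_pos_pos ball_vol_pos) auto
    finally show ?thesis .
  qed
qed

text \<open>One radius in the supremum suffices: the ball of radius \<open>norm x + R\<close> around
  \<open>x\<close> contains the ball of radius \<open>R\<close> around the origin, hence the whole
  mass of \<open>f\<close>.\<close>

lemma maximal_function_ge:
  fixes f :: "real^'n \<Rightarrow> complex"
  assumes supp: "AE y in lebesgue. norm y \<ge> R \<longrightarrow> f y = 0"
    and F: "(\<integral>\<^sup>+y. ennreal (norm (f y)) \<partial>lebesgue) = ennreal F" "F \<ge> 0"
    and "R > 0"
  shows "maximal_function f x \<ge> ennreal (F / ball_vol (norm x + R) TYPE(real^'n))"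
proof -
  let ?r = "norm x + R"
  have r: "?r > 0"
    using \<open>R > 0\<close> by (simp add: add_nonneg_pos)
  have "y \<in> ball x ?r" if "norm y < R" for y
    using that norm_triangle_ineq4[of x y] by (auto simp: dist_norm)
  then have "AE y in lebesgue. ennreal (norm (f y)) = ennreal (norm (f y)) * indicator (ball x ?r) y"
    using supp by (auto split: split_indicator elim!: eventually_mono simp: not_le[symmetric])
  then have "ennreal F = (\<integral>\<^sup>+y\<in>ball x ?r. ennreal (norm (f y)) \<partial>lebesgue)"
    unfolding F(1)[symmetric] by (rule nn_integral_cong_AE)
  moreover have "ennreal F / emeasure lebesgue (ball x ?r) = ennreal (F / ball_vol ?r TYPE(real^'n))"
    using r F by (simp add: emeasure_lborel_ball divide_ennreal ball_vol_pos)
  ultimately show ?thesis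
    unfolding maximal_function_def using r by (intro SUP_upper2[of ?r]) auto
qed

section \<open>Integral bounds with constants independent of the exponent\<close>

text \<open>The threshold \<open>s\<^sub>0\<close> is chosen before \<open>p\<close>, so that
  \<open>p\<close> can tend to 1 with \<open>c\<close> and \<open>s\<^sub>0\<close> fixed. The
  restriction \<open>p < 2\<close> serves to bound \<open>K powr p\<close> by
  \<open>K\<^sup>2\<close>, using \<open>K \<ge> 1\<close>.\<close>

lemma nn_integral_maximal_function_powr_bounds:
  fixes f :: "real^'n \<Rightarrow> complex"
  assumes supp: "AE y in lebesgue. norm y \<ge> R \<longrightarrow> f y = 0" and "R > 0"
    and F: "(\<integral>\<^sup>+y. ennreal (norm (f y)) \<partial>lebesgue) = ennreal F" "F \<ge> 0"
    and K: "AE y in lebesgue. ennreal (norm (f y)) \<le> ennreal K" "K \<ge> 1"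
    and "c > 1"
  obtains s\<^sub>0 where "s\<^sub>0 > 0"
    "\<And>p. 1 < p \<Longrightarrow> p < 2 \<Longrightarrow> ennreal ((F / c) powr p * s\<^sub>0 powr (1 - p))
       \<le> ennreal (p - 1) * (\<integral>\<^sup>+x. ennreal_powr (maximal_function f x) p \<partial>lebesgue)"
    "\<And>p. 1 < p \<Longrightarrow> p < 2 \<Longrightarrow>
       ennreal (p - 1) * (\<integral>\<^sup>+x. ennreal_powr (maximal_function f x) p \<partial>lebesgue)
       \<le> ennreal ((p - 1) * (K\<^sup>2 * s\<^sub>0) + (c * F) powr p * s\<^sub>0 powr (1 - p))"
proof -
  let ?u = "\<lambda>x::real^'n. ball_vol (norm x) TYPE(real^'n)"
  let ?I = "\<lambda>p. \<integral>\<^sup>+x. ennreal_powr (maximal_function f x) p \<partial>lebesgue"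
  obtain t where t: "\<And>s. t \<le> s \<Longrightarrow> R < s \<and> ball_vol (s + R) TYPE(real^'n) \<le> c * ball_vol s TYPE(real^'n)
      \<and> ball_vol s TYPE(real^'n) \<le> c * ball_vol (s - R) TYPE(real^'n)"
    using eventually_ball_vol_shift[OF \<open>c > 1\<close>, of R, where 'a = "real^'n"]
    unfolding eventually_at_top_linorder by blast
  have t0: "t > 0"
    using t[of t] \<open>R > 0\<close> by auto
  \<comment> \<open>With this threshold, \<open>?u x \<ge> s\<^sub>0\<close> forces
    \<open>norm x \<ge> t\<close>, where both volume comparisons hold.\<close>
  define s\<^sub>0 where "s\<^sub>0 = ball_vol t TYPE(real^'n)"
  have s0: "s\<^sub>0 > 0"
    using t0 by (simp add: s\<^sub>0_def ball_vol_pos)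
  have far: "norm x \<ge> t" if "?u x \<ge> s\<^sub>0" for x
    using that t0 ball_vol_less_iff[of "norm x" t, where 'a = "real^'n"] by (auto simp: s\<^sub>0_def not_less[symmetric])
  have upos: "?u x > 0" if "?u x \<ge> s\<^sub>0" for x
    using that s0 by simp
  show ?thesis
  proof (rule that)
    show "s\<^sub>0 > 0" by fact
    fix p :: real assume p: "1 < p" "p < 2"
    \<comment> \<open>The near region is given up here; in the far region the ball of radius
      \<open>norm x + R\<close> has volume at most \<open>c * ?u x\<close>.\<close>
    have lower: "ennreal ((F / c / ?u x) powr p) * indicator {s\<^sub>0..} (?u x)
        \<le> ennreal_powr (maximal_function f x) p" for x
    proof (cases "?u x \<ge> s\<^sub>0")
      case True
      note tx = t[OF far[OF True]]
      have "F / (c * ?u x) \<le> F / ball_vol (norm x + R) TYPE(real^'n)"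
        using tx \<open>R > 0\<close> upos[OF True] \<open>c > 1\<close> F
        by (intro divide_left_mono mult_pos_pos ball_vol_pos) auto
      then have "ennreal (F / c / ?u x) \<le> maximal_function f x"
        using maximal_function_ge[OF supp F \<open>R > 0\<close>, of x]
        by (auto intro: order_trans ennreal_leI)
      then have "ennreal_powr (ennreal (F / c / ?u x)) p \<le> ennreal_powr (maximal_function f x) p"
        using p by (intro ennreal_powr_mono) auto
      then show ?thesis
        using True F \<open>c > 1\<close> upos[OF True] by (simp add: ennreal_powr_ennreal)
    qed auto
    have upper: "ennreal_powr (maximal_function f x) p
        \<le> ennreal (K\<^sup>2) * indicator {..<s\<^sub>0} (?u x)
          + ennreal ((c * F / ?u x) powr p) * indicator {s\<^sub>0..} (?u x)" for x
    proof (cases "?u x \<ge> s\<^sub>0")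
      case True
      note tx = t[OF far[OF True]]
      \<comment> \<open>The fraction is expanded by \<open>c\<close> so that its denominator is the
        one known to dominate \<open>?u x\<close>.\<close>
      have "c * F / (c * ball_vol (norm x - R) TYPE(real^'n)) \<le> c * F / ?u x"
        using tx \<open>R > 0\<close> upos[OF True] \<open>c > 1\<close> F
        by (intro divide_left_mono mult_pos_pos ball_vol_pos) auto
      then have "F / ball_vol (norm x - R) TYPE(real^'n) \<le> c * F / ?u x"
        using \<open>c > 1\<close> by simp
      then have "maximal_function f x \<le> ennreal (c * F / ?u x)"
        using maximal_function_le_far[OF supp F, of x] tx
        by (auto intro: order_trans ennreal_leI)
      then have "ennreal_powr (maximal_function f x) p \<le> ennreal_powr (ennreal (c * F / ?u x)) p"
        using p by (intro ennreal_powr_mono) auto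
      then show ?thesis
        using True F \<open>c > 1\<close> upos[OF True] by (simp add: ennreal_powr_ennreal)
    next
      \<comment> \<open>In the near region the essential bound on \<open>f\<close> also bounds every
        average.\<close>
      case False
      have "ennreal_powr (maximal_function f x) p \<le> ennreal_powr (ennreal K) p"
        using p by (intro ennreal_powr_mono maximal_function_le_bound[OF K(1)]) auto
      also have "\<dots> \<le> ennreal (K powr 2)"
        using K(2) p powr_mono[of p 2 K]
        by (simp add: ennreal_powr_ennreal ennreal_leI del: powr_numeral)
      finally show ?thesis
        using False K(2) by simp
    qed
    \<comment> \<open>Additivity and scaling of the integral are applied to radial comparison
      functions of this kind; \<open>maximal_function f\<close> is compared with them by
      monotonicity.\<close>
    have meas: "(\<lambda>x. h (?u x)) \<in> borel_measurable lebesgue"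
      if "h \<in> borel_measurable borel" for h :: "real \<Rightarrow> ennreal"
      using that by (auto intro!: measurable_completion measurable_compose[OF borel_measurable_ball_vol_norm])
    have "ennreal ((F / c) powr p * s\<^sub>0 powr (1 - p))
        = ennreal (p - 1) * ennreal ((F / c) powr p * s\<^sub>0 powr (1 - p) / (p - 1))"
      using p by (simp flip: ennreal_mult')
    also have "ennreal ((F / c) powr p * s\<^sub>0 powr (1 - p) / (p - 1))
        = (\<integral>\<^sup>+x. ennreal ((F / c / ?u x) powr p) * indicator {s\<^sub>0..} (?u x) \<partial>lebesgue)"
      using F \<open>c > 1\<close> p s0 by (intro nn_integral_ball_vol_norm_powr_tail[symmetric]) auto
    also have "ennreal (p - 1) * \<dots> \<le> ennreal (p - 1) * ?I p"
      by (intro mult_left_mono nn_integral_mono lower) simp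
    finally show "ennreal ((F / c) powr p * s\<^sub>0 powr (1 - p)) \<le> ennreal (p - 1) * ?I p" .
    have "?I p \<le> (\<integral>\<^sup>+x. ennreal (K\<^sup>2) * indicator {..<s\<^sub>0} (?u x)
          + ennreal ((c * F / ?u x) powr p) * indicator {s\<^sub>0..} (?u x) \<partial>lebesgue)"
      by (intro nn_integral_mono upper)
    also have "\<dots> = (\<integral>\<^sup>+x. ennreal (K\<^sup>2) * indicator {..<s\<^sub>0} (?u x) \<partial>lebesgue)
          + (\<integral>\<^sup>+x. ennreal ((c * F / ?u x) powr p) * indicator {s\<^sub>0..} (?u x) \<partial>lebesgue)"
      by (intro nn_integral_add meas[where h = "\<lambda>s. ennreal (K\<^sup>2) * indicator {..<s\<^sub>0} s"]
           meas[where h = "\<lambda>s. ennreal ((c * F / s) powr p) * indicator {s\<^sub>0..} s"]) measurable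
    \<comment> \<open>The near region is a ball of volume \<open>s\<^sub>0\<close>, so its
      contribution is bounded independently of \<open>p\<close> and acquires a factor
      \<open>p - 1\<close> below.\<close>
    also have "(\<integral>\<^sup>+x. ennreal (K\<^sup>2) * indicator {..<s\<^sub>0} (?u x) \<partial>lebesgue) = ennreal (K\<^sup>2) * ennreal s\<^sub>0"
      using s0 nn_integral_ball_vol_norm_below[of s\<^sub>0, where 'a = "real^'n"]
      by (subst nn_integral_cmult) (auto intro!: meas)
    also have "(\<integral>\<^sup>+x. ennreal ((c * F / ?u x) powr p) * indicator {s\<^sub>0..} (?u x) \<partial>lebesgue)
        = ennreal ((c * F) powr p * s\<^sub>0 powr (1 - p) / (p - 1))"
      using F \<open>c > 1\<close> p s0 by (intro nn_integral_ball_vol_norm_powr_tail) auto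
    also have "ennreal (K\<^sup>2) * ennreal s\<^sub>0 + ennreal ((c * F) powr p * s\<^sub>0 powr (1 - p) / (p - 1))
        = ennreal (K\<^sup>2 * s\<^sub>0 + (c * F) powr p * s\<^sub>0 powr (1 - p) / (p - 1))"
      using s0 p by (simp add: ennreal_mult' ennreal_plus)
    finally have "ennreal (p - 1) * ?I p
        \<le> ennreal (p - 1) * ennreal (K\<^sup>2 * s\<^sub>0 + (c * F) powr p * s\<^sub>0 powr (1 - p) / (p - 1))"
      by (rule mult_left_mono) simp
    also have "\<dots> = ennreal ((p - 1) * (K\<^sup>2 * s\<^sub>0) + (c * F) powr p * s\<^sub>0 powr (1 - p))"
      using p by (simp add: distrib_left flip: ennreal_mult')
    finally show "ennreal (p - 1) * ?I p
        \<le> ennreal ((p - 1) * (K\<^sup>2 * s\<^sub>0) + (c * F) powr p * s\<^sub>0 powr (1 - p))" .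
  qed
qed

section \<open>Passage to the limit\<close>

text \<open>The case \<open>D = 0\<close> arises when \<open>f\<close> vanishes almost everywhere;
  the power is still continuous there because the exponent tends to 1, which is positive.\<close>

lemma tendsto_powr_at_right_1:
  fixes D s :: real
  assumes "D \<ge> 0" "s > 0"
  shows "((\<lambda>p. D powr p * s powr (1 - p)) \<longlongrightarrow> D) (at_right 1)"
proof -
  have "((\<lambda>p. D powr p * s powr (1 - p)) \<longlongrightarrow> D powr 1 * s powr (1 - 1)) (at_right 1)"
    using assms by (intro tendsto_intros tendsto_powr') auto
  then show ?thesis
    using assms by simp
qed

theorem theorem6p3:
  fixes f :: "real^'n \<Rightarrow> complex"
  assumes "integrable lebesgue f" and "in_Linf f" and "compact (ess_support f)"
  shows "((\<lambda>p. ennreal (p - 1) * ennreal_powr (Lp_norm p (maximal_function f)) p)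
           \<longlongrightarrow> Lp_norm 1 (pointwise_abs f)) (at_right 1)"
proof -
  let ?I = "\<lambda>p. \<integral>\<^sup>+x. ennreal_powr (maximal_function f x) p \<partial>lebesgue"
  define F where "F = integral\<^sup>L lebesgue (\<lambda>x. norm (f x))"
  have F: "(\<integral>\<^sup>+y. ennreal (norm (f y)) \<partial>lebesgue) = ennreal F" "F \<ge> 0"
    using assms(1) by (auto simp: F_def intro!: nn_integral_eq_integral)
  obtain R where R: "R > 0" "\<And>x. x \<in> ess_support f \<Longrightarrow> norm x < R"
    using compact_imp_bounded[OF assms(3)] bounded_pos_less by blast
  have supp: "AE y in lebesgue. norm y \<ge> R \<longrightarrow> f y = 0"
    using AE_eq_0_outside_ess_support[of f] R(2) by (force elim!: eventually_mono)
  \<comment> \<open>The essential supremum is finite by \<open>in_Linf f\<close>, so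
    \<open>enn2real\<close> loses nothing; the maximum provides \<open>K \<ge> 1\<close>.\<close>
  define K where "K = max 1 (enn2real (esssup lebesgue (pointwise_abs f)))"
  have "ennreal (norm (f y)) \<le> ennreal K"
    if "pointwise_abs f y \<le> esssup lebesgue (pointwise_abs f)" for y
  proof -
    have "esssup lebesgue (pointwise_abs f) \<le> ennreal K"
      using assms(2) by (cases "esssup lebesgue (pointwise_abs f)") (auto simp: in_Linf_def K_def)
    with that show ?thesis
      by (auto simp: pointwise_abs_def)
  qed
  then have K: "AE y in lebesgue. ennreal (norm (f y)) \<le> ennreal K" "K \<ge> 1"
    using esssup_AE[where M = lebesgue and f = "pointwise_abs f"] by (auto simp: K_def elim!: eventually_mono)

  have "((\<lambda>p. ennreal (p - 1) * ?I p) \<longlongrightarrow> ennreal F) (at_right 1)"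
  proof (rule order_tendstoI)
    fix a assume a: "a < ennreal F"
    \<comment> \<open>The order of choices matters: first \<open>c\<close> close enough to 1 that
      \<open>F / c\<close> still exceeds \<open>a\<close>, then \<open>s\<^sub>0\<close> depending
      on \<open>c\<close>, and only then \<open>p\<close> close to 1.\<close>
    have "((\<lambda>c. ennreal (F / c)) \<longlongrightarrow> ennreal (F / 1)) (at_right 1)"
      by (intro tendsto_intros) auto
    then have "\<forall>\<^sub>F c in at_right 1. a < ennreal (F / c)"
      using a by (auto dest: order_tendstoD)
    moreover have "\<forall>\<^sub>F c in at_right (1::real). 1 < c"
      by (rule eventually_at_right_less)
    ultimately obtain c where c: "c > 1" "a < ennreal (F / c)"
      using eventually_happens'[OF trivial_limit_at_right_real eventually_conj] by blast
    obtain s\<^sub>0 where s\<^sub>0: "s\<^sub>0 > 0" "\<And>p. 1 < p \<Longrightarrow> p < 2 \<Longrightarrow>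
        ennreal ((F / c) powr p * s\<^sub>0 powr (1 - p)) \<le> ennreal (p - 1) * ?I p"
      "\<And>p. 1 < p \<Longrightarrow> p < 2 \<Longrightarrow> ennreal (p - 1) * ?I p
        \<le> ennreal ((p - 1) * (K\<^sup>2 * s\<^sub>0) + (c * F) powr p * s\<^sub>0 powr (1 - p))"
      by (rule nn_integral_maximal_function_powr_bounds[OF supp R(1) F K c(1)]) blast
    have "((\<lambda>p. ennreal ((F / c) powr p * s\<^sub>0 powr (1 - p))) \<longlongrightarrow> ennreal (F / c)) (at_right 1)"
      using F c s\<^sub>0(1) by (intro tendsto_ennrealI tendsto_powr_at_right_1) auto
    then have "\<forall>\<^sub>F p in at_right 1. a < ennreal ((F / c) powr p * s\<^sub>0 powr (1 - p))"
      using c(2) by (rule order_tendstoD)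
    moreover have "\<forall>\<^sub>F p in at_right (1::real). p \<in> {1<..<2}"
      by (rule eventually_at_right_real) simp
    ultimately show "\<forall>\<^sub>F p in at_right 1. a < ennreal (p - 1) * ?I p"
      by eventually_elim (use s\<^sub>0(2) in \<open>auto intro: less_le_trans\<close>)
  next
    fix a assume a: "ennreal F < a"
    \<comment> \<open>Symmetrically, \<open>c\<close> is now chosen with \<open>c * F\<close> still
      below \<open>a\<close>.\<close>
    have "((\<lambda>c. ennreal (c * F)) \<longlongrightarrow> ennreal (1 * F)) (at_right 1)"
      by (intro tendsto_intros)
    then have "\<forall>\<^sub>F c in at_right 1. ennreal (c * F) < a"
      using a by (auto dest: order_tendstoD)
    moreover have "\<forall>\<^sub>F c in at_right (1::real). 1 < c"
      by (rule eventually_at_right_less)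
    ultimately obtain c where c: "c > 1" "ennreal (c * F) < a"
      using eventually_happens'[OF trivial_limit_at_right_real eventually_conj] by blast
    obtain s\<^sub>0 where s\<^sub>0: "s\<^sub>0 > 0" "\<And>p. 1 < p \<Longrightarrow> p < 2 \<Longrightarrow>
        ennreal ((F / c) powr p * s\<^sub>0 powr (1 - p)) \<le> ennreal (p - 1) * ?I p"
      "\<And>p. 1 < p \<Longrightarrow> p < 2 \<Longrightarrow> ennreal (p - 1) * ?I p
        \<le> ennreal ((p - 1) * (K\<^sup>2 * s\<^sub>0) + (c * F) powr p * s\<^sub>0 powr (1 - p))"
      by (rule nn_integral_maximal_function_powr_bounds[OF supp R(1) F K c(1)]) blast
    \<comment> \<open>The near contribution dies with \<open>p - 1\<close>, and only
      \<open>c * F\<close> survives.\<close>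
    have "((\<lambda>p. ennreal ((p - 1) * (K\<^sup>2 * s\<^sub>0) + (c * F) powr p * s\<^sub>0 powr (1 - p)))
        \<longlongrightarrow> ennreal ((1 - 1) * (K\<^sup>2 * s\<^sub>0) + c * F)) (at_right 1)"
      using F c s\<^sub>0(1) by (intro tendsto_ennrealI tendsto_add tendsto_powr_at_right_1 tendsto_intros) auto
    then have "\<forall>\<^sub>F p in at_right 1. ennreal ((p - 1) * (K\<^sup>2 * s\<^sub>0) + (c * F) powr p * s\<^sub>0 powr (1 - p)) < a"
      using c(2) by (intro order_tendstoD(2)) auto
    moreover have "\<forall>\<^sub>F p in at_right (1::real). p \<in> {1<..<2}"
      by (rule eventually_at_right_real) simp
    ultimately show "\<forall>\<^sub>F p in at_right 1. ennreal (p - 1) * ?I p < a"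
      by eventually_elim (use s\<^sub>0(3) in \<open>auto intro: le_less_trans\<close>)
  qed
  \<comment> \<open>To the right of 1 the exponent is positive, so taking the root and then the
    power is the identity.\<close>
  moreover have "\<forall>\<^sub>F p in at_right 1. ennreal (p - 1) * ?I p
      = ennreal (p - 1) * ennreal_powr (Lp_norm p (maximal_function f)) p"
    using eventually_at_right_less
    by (rule eventually_mono) (simp add: Lp_norm_def ennreal_powr_inverse)
  moreover have "Lp_norm 1 (pointwise_abs f) = ennreal F"
    using F by (simp add: Lp_norm_def pointwise_abs_def ennreal_powr_ennreal)
  ultimately show ?thesis
    by (simp add: tendsto_cong)
qed

end
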